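(* Let $B$ be a Hermitian $n\times n$ matrix with eigenvalues sorted in non-decreasing order, $b_1\le b_2\le\ldots\le b_n$. Let $f$ be a real-valued function, differentiable at each $b_j$, let $L$ be the Loewner matrix of $f$ at $B$, and put $\alpha=f'(b_1)$, $\beta=f'(b_n)$ and $\phi=(1+\sqrt5)/2$. If $f$ is concave on the interval $[b_1,b_n]$, then $$\|S_L\| \le (\alpha-\beta)+\min\Big(|\beta|+\phi^{-1}\sum_{j=1}^{n}(\alpha-f'(b_j)),\ |\alpha|+\phi^{-1}\sum_{j=1}^{n}(f'(b_j)-\beta)\Big).$$ If $f$ is convex on the interval $[b_1,b_n]$, then $$\|S_L\| \le (\beta-\alpha)+\min\Big(|\beta|+\phi^{-1}\sum_{j=1}^{n}(f'(b_j)-\alpha),\ |\alpha|+\phi^{-1}\sum_{j=1}^{n}(\beta-f'(b_j))\Big).$$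
   Context: The Loewner matrix of $f$ at a Hermitian matrix $B$ with eigenvalues $b_1,\dots,b_n$ is the $n\times n$ matrix $L$ with $L_{ij}=\frac{f(b_i)-f(b_j)}{b_i-b_j}$ if $b_i\ne b_j$ and $L_{ij}=f'(b_i)$ if $b_i=b_j$. $S_L$ is the Schur multiplier $A\mapsto L\circ A$ on complex $n\times n$ matrices, where $(L\circ A)_{ij}=L_{ij}A_{ij}$. $\|S_L\|=\sup_{A\neq 0}\|L\circ A\|/\|A\|$, where $\|\cdot\|$ is the operator (spectral) norm on matrices. *)

theory Defs
  imports "HOL-Analysis.Analysis" "HOL-Computational_Algebra.Polynomial"
begin

definition hermitian :: "complex^'n^'n \<Rightarrow> bool" where
  "hermitian B \<longleftrightarrow> (\<forall>i j. B $ i $ j = cnj (B $ j $ i))"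

text \<open>The characteristic polynomial \<open>det (x I - A)\<close>, as a determinant over the polynomial ring.\<close>

definition char_poly :: "'a::comm_ring_1^'n^'n \<Rightarrow> 'a poly" where
  "char_poly A = det (\<chi> i j. (if i = j then [:0, 1:] else 0) - [:A $ i $ j:])"

text \<open>The family \<open>b\<close> lists the eigenvalues of \<open>B\<close> with multiplicity.\<close>

definition eigenvalue_family :: "complex^'n^'n \<Rightarrow> ('n \<Rightarrow> real) \<Rightarrow> bool" where
  "eigenvalue_family B b \<longleftrightarrow> char_poly B = (\<Prod>i\<in>UNIV. [:- complex_of_real (b i), 1:])"

definition loewner_matrix :: "(real \<Rightarrow> real) \<Rightarrow> ('n \<Rightarrow> real) \<Rightarrow> complex^'n^'n" where
  "loewner_matrix f b = (\<chi> i j. complex_of_real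
     (if b i = b j then deriv f (b i) else (f (b i) - f (b j)) / (b i - b j)))"

definition schur_multiplier :: "complex^'n^'n \<Rightarrow> complex^'n^'n \<Rightarrow> complex^'n^'n" where
  "schur_multiplier L A = (\<chi> i j. L $ i $ j * A $ i $ j)"

text \<open>The library's \<open>norm\<close> on matrices is the Frobenius norm. The spectral norm is the
  operator norm with respect to the Euclidean norm on vectors.\<close>

definition spectral_norm :: "complex^'n^'n \<Rightarrow> real" where
  "spectral_norm A = onorm (\<lambda>x. A *v x)"

definition schur_multiplier_norm :: "complex^'n^'n \<Rightarrow> real" where
  "schur_multiplier_norm L =
     (SUP A\<in>{A. A \<noteq> 0}. spectral_norm (schur_multiplier L A) / spectral_norm A)"

definition golden_ratio :: real where
  "golden_ratio = (1 + sqrt 5) / 2"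

text \<open>The supremum defining \<open>schur_multiplier_norm\<close> is over a nonempty set that is bounded above,
  so it is not an unspecified value.\<close>

lemma bounded_linear_matrix_vector_mult_complex:
  "bounded_linear (\<lambda>x. (A::complex^'n^'n) *v x)"
  by (intro linear_conv_bounded_linear[THEN iffD1] linearI)
     (auto simp: matrix_vector_mult_def vec_eq_iff algebra_simps sum.distrib scaleR_sum_right)

lemma spectral_norm_nonneg: "0 \<le> spectral_norm A"
  unfolding spectral_norm_def
  by (rule onorm_pos_le[OF bounded_linear_matrix_vector_mult_complex])

lemma norm_entry_le_spectral_norm: "cmod (A $ i $ j) \<le> spectral_norm A"
proof -
  have "A $ i $ j = (A *v axis j 1) $ i"
    by (simp add: matrix_vector_mult_def axis_def if_distrib cong: if_cong)
  then have "cmod (A $ i $ j) \<le> norm (A *v axis j 1)"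
    using Finite_Cartesian_Product.norm_nth_le by metis
  also have "\<dots> \<le> spectral_norm A * norm (axis j 1 :: complex^'a)"
    unfolding spectral_norm_def
    by (rule onorm[OF bounded_linear_matrix_vector_mult_complex])
  finally show ?thesis by (simp add: norm_axis_1)
qed

lemma spectral_norm_le_sum_entries:
  "spectral_norm A \<le> (\<Sum>i\<in>UNIV. \<Sum>j\<in>UNIV. cmod (A $ i $ j))"
  unfolding spectral_norm_def
proof (rule onorm_bound)
  fix x :: "complex^'a"
  have "norm (A *v x) \<le> (\<Sum>i\<in>UNIV. cmod ((A *v x) $ i))"
    by (simp add: norm_vec_def L2_set_le_sum)
  also have "\<dots> \<le> (\<Sum>i\<in>UNIV. \<Sum>j\<in>UNIV. cmod (A $ i $ j) * norm x)"
    by (auto simp: matrix_vector_mult_def norm_mult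
        intro!: sum_mono order_trans[OF norm_sum] mult_left_mono Finite_Cartesian_Product.norm_nth_le)
  finally show "norm (A *v x) \<le> (\<Sum>i\<in>UNIV. \<Sum>j\<in>UNIV. cmod (A $ i $ j)) * norm x"
    by (simp add: sum_distrib_right)
qed (auto intro!: sum_nonneg)

lemma schur_multiplier_norm_bdd_above:
  "bdd_above ((\<lambda>A. spectral_norm (schur_multiplier L A) / spectral_norm A) ` {A. A \<noteq> 0})"
proof (rule bdd_aboveI2)
  fix A :: "complex^'a^'a"
  assume "A \<in> {A. A \<noteq> 0}"
  then obtain i j where "A $ i $ j \<noteq> 0" by (auto simp: vec_eq_iff)
  then have pos: "0 < spectral_norm A"
    using norm_entry_le_spectral_norm[of A i j] by (smt (verit) zero_less_norm_iff)
  have "spectral_norm (schur_multiplier L A)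
      \<le> (\<Sum>i\<in>UNIV. \<Sum>j\<in>UNIV. cmod (L $ i $ j) * cmod (A $ i $ j))"
    using spectral_norm_le_sum_entries[of "schur_multiplier L A"]
    by (simp add: schur_multiplier_def norm_mult)
  also have "\<dots> \<le> (\<Sum>i\<in>UNIV. \<Sum>j\<in>UNIV. cmod (L $ i $ j) * spectral_norm A)"
    by (intro sum_mono mult_left_mono norm_entry_le_spectral_norm) auto
  finally show "spectral_norm (schur_multiplier L A) / spectral_norm A
      \<le> (\<Sum>i\<in>UNIV. \<Sum>j\<in>UNIV. cmod (L $ i $ j))"
    using pos by (simp add: divide_le_eq sum_distrib_right)
qed

lemma nonzero_matrices_nonempty: "{A. A \<noteq> (0::complex^'n^'n)} \<noteq> {}"
proof -
  have "(\<chi> i j. 1) \<noteq> (0::complex^'n^'n)" by (simp add: vec_eq_iff)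
  then show ?thesis by blast
qed

end

theory Submission
  imports Defs
begin

text \<open>
  Every entry of the Loewner matrix lies between the corresponding two diagonal entries, because
  slopes of a convex or concave function lie between the derivatives at the two end points. A real
  matrix \<open>M\<close> with this property is cut into layers at the values of its diagonal. If \<open>\<delta>\<close> is the
  thickness of a layer, the layer is, up to a permutation of the indices, \<open>\<delta>\<close> times a block matrix
  \<open>[[J, X], [Y, 0]]\<close>, where \<open>J\<close> is an all-ones block and the entries of \<open>X\<close> and \<open>Y\<close> are at most 1
  in modulus. If the zero block has size \<open>m\<close>, then \<open>X\<close> and \<open>Y\<close> act as Schur multipliers of norm at
  most \<open>\<surd>m\<close>, so the layer has norm at most \<open>\<delta>\<close> times the largest eigenvalue of
  \<open>[[1, \<surd>m], [\<surd>m, 0]]\<close>, which is at most \<open>1 + m/\<phi>\<close> (with equality for \<open>m = 1\<close>). Summing over the layers gives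
  the first bound, and applying it to \<open>-M\<close> gives the second.
\<close>

subsection \<open>Schur multipliers and the spectral norm\<close>

lemma norm_matrix_vector_le:
  "norm (A *v x) \<le> spectral_norm A * norm x"
  for A :: "complex^'n^'n"
  unfolding spectral_norm_def by (rule onorm[OF bounded_linear_matrix_vector_mult_complex])

lemma spectral_norm_le:
  fixes A :: "complex^'n^'n"
  assumes "\<And>x. norm (A *v x) \<le> K * norm x"
  shows "spectral_norm A \<le> K"
proof -
  \<comment> \<open>\<open>onorm_bound\<close> also asks for 0 <= K; testing the assumption on a
    unit vector supplies it.\<close>
  have "0 \<le> K * norm (axis undefined 1 :: complex^'n)"
    using assms norm_ge_zero order_trans by blast
  then have "0 \<le> K" by (simp add: norm_axis_1)
  then show ?thesis
    unfolding spectral_norm_def by (intro onorm_bound assms)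
qed

lemma spectral_norm_pos:
  assumes "A \<noteq> 0"
  shows "0 < spectral_norm A"
proof -
  from assms obtain i j where "A $ i $ j \<noteq> 0" by (auto simp: vec_eq_iff)
  then show ?thesis
    using norm_entry_le_spectral_norm[of A i j] by (smt (verit) zero_less_norm_iff)
qed

lemma spectral_norm_triangle:
  "spectral_norm (A + B) \<le> spectral_norm A + spectral_norm B"
  for A B :: "complex^'n^'n"
  by (rule spectral_norm_le)
    (smt (verit) distrib_right matrix_vector_mult_add_rdistrib norm_matrix_vector_le norm_triangle_ineq)

lemma spectral_norm_schur_multiplier_le:
  "spectral_norm (schur_multiplier L A) \<le> schur_multiplier_norm L * spectral_norm A"
proof (cases "A = 0")
  case True
  then show ?thesis
    by (simp add: schur_multiplier_def spectral_norm_def onorm_zero zero_vec_def[symmetric])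
next
  case False
  then have "spectral_norm (schur_multiplier L A) / spectral_norm A \<le> schur_multiplier_norm L"
    unfolding schur_multiplier_norm_def
    by (intro cSUP_upper schur_multiplier_norm_bdd_above) auto
  then show ?thesis
    using spectral_norm_pos[OF False] by (simp add: divide_le_eq)
qed

text \<open>All upper bounds below are proved in this form, for every matrix and vector, so that the
  quotient and the supremum do not appear again.\<close>

lemma schur_multiplier_norm_le:
  assumes "\<And>A x. norm (schur_multiplier L A *v x) \<le> K * spectral_norm A * norm x"
  shows "schur_multiplier_norm L \<le> K"
  unfolding schur_multiplier_norm_def
proof (rule cSUP_least[OF nonzero_matrices_nonempty])
  fix A :: "complex^'a^'a"
  assume "A \<in> {A. A \<noteq> 0}"
  then have "0 < spectral_norm A" by (simp add: spectral_norm_pos)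
  moreover have "spectral_norm (schur_multiplier L A) \<le> K * spectral_norm A"
    by (rule spectral_norm_le) (rule assms)
  ultimately show "spectral_norm (schur_multiplier L A) / spectral_norm A \<le> K"
    by (simp add: divide_le_eq)
qed

lemma schur_multiplier_norm_triangle:
  "schur_multiplier_norm (L + M) \<le> schur_multiplier_norm L + schur_multiplier_norm M"
proof (rule schur_multiplier_norm_le)
  fix A :: "complex^'a^'a" and x
  have "schur_multiplier (L + M) A = schur_multiplier L A + schur_multiplier M A"
    by (simp add: schur_multiplier_def vec_eq_iff algebra_simps)
  then have "spectral_norm (schur_multiplier (L + M) A)
      \<le> (schur_multiplier_norm L + schur_multiplier_norm M) * spectral_norm A"
    using spectral_norm_triangle[of "schur_multiplier L A" "schur_multiplier M A"]
      spectral_norm_schur_multiplier_le[of L A] spectral_norm_schur_multiplier_le[of M A]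
    by (simp add: distrib_right)
  then show "norm (schur_multiplier (L + M) A *v x)
      \<le> (schur_multiplier_norm L + schur_multiplier_norm M) * spectral_norm A * norm x"
    using norm_matrix_vector_le[of "schur_multiplier (L + M) A" x]
    by (smt (verit) mult_right_mono norm_ge_zero)
qed

text \<open>Applied to \<open>- L\<close> it yields the reverse inequality, which is how the passage
  from M to -M uses it.\<close>

lemma schur_multiplier_norm_uminus_le:
  "schur_multiplier_norm (- L) \<le> schur_multiplier_norm L"
proof (rule schur_multiplier_norm_le)
  fix A :: "complex^'a^'a" and x
  have "schur_multiplier (- L) A *v x = - (schur_multiplier L A *v x)"
    by (simp add: schur_multiplier_def vec_eq_iff matrix_vector_mult_def sum_negf)
  then have "norm (schur_multiplier (- L) A *v x) = norm (schur_multiplier L A *v x)"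
    by simp
  also have "\<dots> \<le> spectral_norm (schur_multiplier L A) * norm x"
    by (rule norm_matrix_vector_le)
  also have "\<dots> \<le> schur_multiplier_norm L * spectral_norm A * norm x"
    by (intro mult_right_mono spectral_norm_schur_multiplier_le) auto
  finally show "norm (schur_multiplier (- L) A *v x) \<le> schur_multiplier_norm L * spectral_norm A * norm x" .
qed

lemma schur_multiplier_norm_const_le:
  "schur_multiplier_norm (\<chi> i j. c) \<le> cmod c"
proof (rule schur_multiplier_norm_le)
  fix A :: "complex^'a^'a" and x
  have "schur_multiplier (\<chi> i j. c) A *v x = c *s (A *v x)"
    by (simp add: schur_multiplier_def vec_eq_iff matrix_vector_mult_def sum_distrib_left mult.assoc)
  moreover have "norm (c *s (A *v x)) = cmod c * norm (A *v x)"
    by (simp add: norm_vec_def norm_mult L2_set_right_distrib)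
  ultimately show "norm (schur_multiplier (\<chi> i j. c) A *v x) \<le> cmod c * spectral_norm A * norm x"
    using norm_matrix_vector_le[of A x] by (simp add: mult.assoc mult_left_mono)
qed

lemma L2_set_column_le_spectral_norm:
  "L2_set (\<lambda>i. cmod (A $ i $ j)) UNIV \<le> spectral_norm A"
proof -
  have "A *v axis j 1 = (\<chi> i. A $ i $ j)"
    by (simp add: vec_eq_iff matrix_vector_mult_def axis_def if_distrib cong: if_cong)
  then have "L2_set (\<lambda>i. cmod (A $ i $ j)) UNIV = norm (A *v axis j 1)"
    by (simp add: norm_vec_def)
  also have "\<dots> \<le> spectral_norm A * norm (axis j 1 :: complex^'a)"
    by (rule norm_matrix_vector_le)
  finally show ?thesis by (simp add: norm_axis_1)
qed

lemma L2_set_row_le_spectral_norm: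
  "L2_set (\<lambda>j. cmod (A $ i $ j)) UNIV \<le> spectral_norm A"
proof -
  define r where "r = L2_set (\<lambda>j. cmod (A $ i $ j)) UNIV"
  \<comment> \<open>The conjugated row is the test vector: its norm is r, while coordinate i of
    \<open>A *v x\<close> is r^2.\<close>
  define x where "x = (\<chi> j. cnj (A $ i $ j))"
  have r0: "0 \<le> r" by (simp add: r_def)
  have x: "norm x = r" by (simp add: x_def r_def norm_vec_def)
  have "(A *v x) $ i = (\<Sum>j\<in>UNIV. complex_of_real ((cmod (A $ i $ j))\<^sup>2))"
    by (simp add: matrix_vector_mult_def x_def complex_norm_square[symmetric] del: of_real_power)
  also have "\<dots> = complex_of_real (r\<^sup>2)"
    by (simp add: r_def L2_set_def sum_nonneg)
  finally have "r\<^sup>2 = cmod ((A *v x) $ i)" by (simp add: norm_power r0)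
  also have "\<dots> \<le> norm (A *v x)" by (rule Finite_Cartesian_Product.norm_nth_le)
  also have "\<dots> \<le> spectral_norm A * r" using norm_matrix_vector_le[of A x] by (simp add: x)
  finally have "r * r \<le> spectral_norm A * r" by (simp add: power2_eq_square)
  then show ?thesis
    using r0 spectral_norm_nonneg[of A] unfolding r_def[symmetric]
    by (cases "r = 0") auto
qed

subsection \<open>A single layer\<close>

lemma L2_set_subset_le:
  assumes "finite B" "A \<subseteq> B"
  shows "L2_set f A \<le> L2_set f B"
  unfolding L2_set_def using assms by (intro real_sqrt_le_mono sum_mono2) auto

text \<open>These two facts are all that the estimates use about the golden ratio.\<close>

lemma golden_ratio_inverse:
  "0 < inverse golden_ratio" "inverse golden_ratio * inverse golden_ratio = 1 - inverse golden_ratio"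
proof -
  have pos: "golden_ratio > 0" by (simp add: golden_ratio_def add_pos_pos)
  then show "0 < inverse golden_ratio" by simp
  have "golden_ratio\<^sup>2 = golden_ratio + 1"
    by (simp add: golden_ratio_def power2_eq_square field_simps)
  with pos show "inverse golden_ratio * inverse golden_ratio = 1 - inverse golden_ratio"
    by (simp add: field_simps power2_eq_square)
qed

text \<open>The left side is the squared length of T (p, q) for T = [[1, c], [c, 0]] with c = sqrt
  m. With k = 1 + m/\<phi>, the claim says that k^2 - T^2 is positive semidefinite.\<close>

lemma golden_block_bound:
  fixes p q :: real and m :: nat
  shows "(p + sqrt m * q)\<^sup>2 + (sqrt m * p)\<^sup>2
    \<le> (1 + inverse golden_ratio * m)\<^sup>2 * (p\<^sup>2 + q\<^sup>2)"
proof (cases "m = 0")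
  case True
  then show ?thesis by simp
next
  case False
  define s where "s = inverse golden_ratio"
  define k where "k = 1 + s * m"
  define c where "c = sqrt m"
  have s: "0 < s" "s * s = 1 - s" using golden_ratio_inverse by (auto simp: s_def)
  have m: "real m \<ge> 1" using False by simp
  have c: "c * c = m" by (simp add: c_def)
  \<comment> \<open>This is the characteristic polynomial of T at k. By s^2 = 1 - s it equals m (m -
    1) s^2, which vanishes for m = 1.\<close>
  have "k * k - k - m = m * (s + m * (s * s) - 1)"
    by (simp add: k_def algebra_simps)
  also have "\<dots> = real m * (real m - 1) * (s * s)"
    unfolding s(2) by (simp add: algebra_simps)
  also have "\<dots> \<ge> 0"
    using m s(1) by (intro mult_nonneg_nonneg) auto
  finally have k2: "k + m \<le> k * k" by simp
  have k1: "1 < k" using s m by (simp add: k_def)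
  \<comment> \<open>k^2 - T^2 is [[a, -c], [-c, d]], so it remains to show that its determinant a d
    - m is nonnegative. This follows from a >= k - 1, d >= k and (k - 1) k >= m.\<close>
  define a where "a = k * k - 1 - m"
  define d where "d = k * k - m"
  have a: "a > 0" "d > 0" using k1 k2 by (auto simp: a_def d_def)
  have "real m \<le> (k - 1) * k" using k2 by (simp add: algebra_simps)
  also have "\<dots> \<le> a * d" using k1 k2 by (intro mult_mono) (auto simp: a_def d_def)
  finally have ad: "m \<le> a * d" .
  \<comment> \<open>Completing the square in the quadratic form multiplied by a.\<close>
  have "0 \<le> (a * p - c * q)\<^sup>2 + (a * d - m) * q\<^sup>2" using ad by simp
  also have "\<dots> = a * (a * p\<^sup>2 - 2 * c * p * q + d * q\<^sup>2) + (c * c - m) * q\<^sup>2"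
    by (simp add: power2_eq_square algebra_simps)
  finally have "0 \<le> a * p\<^sup>2 - 2 * c * p * q + d * q\<^sup>2"
    using a c by (simp add: zero_le_mult_iff)
  moreover have "(p + c * q)\<^sup>2 + (c * p)\<^sup>2 = p\<^sup>2 + 2 * c * p * q + (c * c) * q\<^sup>2 + (c * c) * p\<^sup>2"
    by (simp add: power2_eq_square algebra_simps)
  ultimately have "(p + c * q)\<^sup>2 + (c * p)\<^sup>2 \<le> k\<^sup>2 * (p\<^sup>2 + q\<^sup>2)"
    unfolding c a_def d_def by (simp add: power2_eq_square algebra_simps)
  then show ?thesis by (simp add: k_def c_def s_def)
qed

text \<open>Both x and its image y are split along \<open>I\<close> and its complement of size m.
  With p and q the norms of the two parts of x, and a that of A, the parts of y are at most \<delta>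
  a (p + c q) and \<delta> a c p, where c = sqrt m. Then \<open>golden_block_bound\<close>
  applies.\<close>

lemma schur_multiplier_norm_layer_le:
  fixes W :: "'n::finite \<Rightarrow> 'n \<Rightarrow> real"
  assumes one: "\<And>i j. i \<in> I \<Longrightarrow> j \<in> I \<Longrightarrow> W i j = \<delta>"
    and zero: "\<And>i j. i \<notin> I \<Longrightarrow> j \<notin> I \<Longrightarrow> W i j = 0"
    and bound: "\<And>i j. \<bar>W i j\<bar> \<le> \<delta>"
  shows "schur_multiplier_norm (\<chi> i j. complex_of_real (W i j))
    \<le> \<delta> * (1 + inverse golden_ratio * card (- I))"
proof (rule schur_multiplier_norm_le)
  fix A :: "complex^'n^'n" and x :: "complex^'n"
  define a where "a = spectral_norm A"
  define y where "y = schur_multiplier (\<chi> i j. complex_of_real (W i j)) A *v x"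
  define p where "p = L2_set (\<lambda>j. cmod (x $ j)) I"
  define q where "q = L2_set (\<lambda>j. cmod (x $ j)) (- I)"
  define c where "c = sqrt (card (- I))"
  define R where "R i = L2_set (\<lambda>j. cmod (A $ i $ j)) (- I)" for i
  define k where "k = 1 + inverse golden_ratio * card (- I)"
  have \<delta>: "0 \<le> \<delta>" using bound abs_ge_zero order_trans by blast
  have a: "0 \<le> a" by (simp add: a_def spectral_norm_nonneg)
  have pq: "0 \<le> p" "0 \<le> q" "0 \<le> c" by (auto simp: p_def q_def c_def)
  have k: "0 \<le> k" using golden_ratio_inverse by (simp add: k_def)
  have split: "sum g UNIV = sum g I + sum g (- I)" for g :: "'n \<Rightarrow> 'b::comm_monoid_add"
    using sum.union_disjoint[of I "- I" g] by (simp add: Compl_partition)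
  have split_norm: "(norm z)\<^sup>2 = (L2_set (\<lambda>j. cmod (z $ j)) I)\<^sup>2 + (L2_set (\<lambda>j. cmod (z $ j)) (- I))\<^sup>2"
    for z :: "complex^'n"
    by (simp add: norm_vec_def L2_set_def sum_nonneg split)
  have y: "y $ i = (\<Sum>j\<in>I. W i j * A $ i $ j * x $ j) + (\<Sum>j\<in>-I. W i j * A $ i $ j * x $ j)" for i
    by (simp add: y_def schur_multiplier_def matrix_vector_mult_def split)
  \<comment> \<open>Cauchy-Schwarz on the columns in S, after bounding the weights by
    \<delta>.\<close>
  have part: "cmod (\<Sum>j\<in>S. W i j * A $ i $ j * x $ j)
      \<le> \<delta> * (L2_set (\<lambda>j. cmod (A $ i $ j)) S * L2_set (\<lambda>j. cmod (x $ j)) S)" for i S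
  proof -
    have "cmod (\<Sum>j\<in>S. W i j * A $ i $ j * x $ j)
        \<le> (\<Sum>j\<in>S. \<delta> * (\<bar>cmod (A $ i $ j)\<bar> * \<bar>cmod (x $ j)\<bar>))"
      by (intro sum_norm_le)
        (use bound in \<open>auto simp: norm_mult mult.assoc intro!: mult_right_mono\<close>)
    also have "\<dots> = \<delta> * (\<Sum>j\<in>S. \<bar>cmod (A $ i $ j)\<bar> * \<bar>cmod (x $ j)\<bar>)"
      by (simp add: sum_distrib_left)
    also have "\<dots> \<le> \<delta> * (L2_set (\<lambda>j. cmod (A $ i $ j)) S * L2_set (\<lambda>j. cmod (x $ j)) S)"
      by (intro mult_left_mono L2_set_mult_ineq \<delta>)
    finally show ?thesis .
  qed
  \<comment> \<open>Outside \<open>I\<close> the zero block leaves only the columns in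
    \<open>I\<close>, and a row of A has length at most a. Taking the L2 norm over these m rows
    produces the factor c.\<close>
  have "cmod (y $ i) \<le> \<delta> * a * p" if "i \<notin> I" for i
  proof -
    have "y $ i = (\<Sum>j\<in>I. W i j * A $ i $ j * x $ j)"
      using zero[OF that] by (simp add: y)
    then have "cmod (y $ i) \<le> \<delta> * (L2_set (\<lambda>j. cmod (A $ i $ j)) I * p)"
      using part[of i I] by (simp add: p_def)
    also have "\<dots> \<le> \<delta> * (a * p)"
      unfolding a_def using \<delta> pq
      by (intro mult_left_mono mult_right_mono
          order_trans[OF L2_set_subset_le L2_set_row_le_spectral_norm]) auto
    finally show ?thesis by (simp add: mult.assoc)
  qed
  then have "L2_set (\<lambda>i. cmod (y $ i)) (- I) \<le> L2_set (\<lambda>i. \<delta> * a * p) (- I)"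
    by (intro L2_set_mono) auto
  also have "\<dots> = \<delta> * a * (c * p)"
    using \<delta> a pq by (simp add: L2_set_constant c_def)
  finally have lower: "L2_set (\<lambda>i. cmod (y $ i)) (- I) \<le> \<delta> * a * (c * p)" .

  \<comment> \<open>On the constant block the multiplier acts as \<delta> A on the truncated vector,
    so this part costs the spectral norm of A without a factor c.\<close>
  define xI where "xI = (\<chi> j. if j \<in> I then x $ j else 0)"
  have xI: "norm xI = p"
  proof -
    have "(norm xI)\<^sup>2 = p\<^sup>2"
      unfolding split_norm[of xI] by (simp add: xI_def p_def L2_set_def)
    then show ?thesis using pq by simp
  qed
  \<comment> \<open>The remaining block is controlled by its Frobenius norm: summed by columns, it
    has m columns of length at most a.\<close>
  have "(L2_set R I)\<^sup>2 \<le> (\<Sum>i\<in>UNIV. \<Sum>j\<in>-I. (cmod (A $ i $ j))\<^sup>2)"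
    unfolding R_def L2_set_def by (simp add: sum_nonneg sum_mono2)
  also have "\<dots> = (\<Sum>j\<in>-I. (L2_set (\<lambda>i. cmod (A $ i $ j)) UNIV)\<^sup>2)"
    by (subst sum.swap) (simp add: L2_set_def sum_nonneg)
  also have "\<dots> \<le> (\<Sum>j\<in>-I. a\<^sup>2)"
    unfolding a_def by (intro sum_mono power_mono L2_set_column_le_spectral_norm) auto
  also have "\<dots> = (c * a)\<^sup>2" by (simp add: c_def power_mult_distrib)
  finally have R: "L2_set R I \<le> c * a"
    using a pq by (auto intro: power2_le_imp_le)
  have "cmod (y $ i) \<le> \<delta> * cmod ((A *v xI) $ i) + \<delta> * q * R i" if "i \<in> I" for i
  proof -
    have "(A *v xI) $ i = (\<Sum>j\<in>I. A $ i $ j * x $ j)"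
      by (simp add: matrix_vector_mult_def split xI_def)
    then have "y $ i = \<delta> * (A *v xI) $ i + (\<Sum>j\<in>-I. W i j * A $ i $ j * x $ j)"
      by (simp add: y one[OF that] sum_distrib_left mult.assoc)
    moreover have "cmod (\<delta> * (A *v xI) $ i) = \<delta> * cmod ((A *v xI) $ i)"
      using \<delta> by (simp add: norm_mult)
    ultimately have "cmod (y $ i) \<le> \<delta> * cmod ((A *v xI) $ i)
        + cmod (\<Sum>j\<in>-I. W i j * A $ i $ j * x $ j)"
      by (metis norm_triangle_ineq)
    also have "cmod (\<Sum>j\<in>-I. W i j * A $ i $ j * x $ j) \<le> \<delta> * q * R i"
      using part[of i "- I"] by (simp add: R_def q_def ac_simps)
    finally show ?thesis by simp
  qed
  then have "L2_set (\<lambda>i. cmod (y $ i)) I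
      \<le> L2_set (\<lambda>i. \<delta> * cmod ((A *v xI) $ i) + \<delta> * q * R i) I"
    by (intro L2_set_mono) auto
  also have "\<dots> \<le> L2_set (\<lambda>i. \<delta> * cmod ((A *v xI) $ i)) I + L2_set (\<lambda>i. \<delta> * q * R i) I"
    by (rule L2_set_triangle_ineq)
  also have "\<dots> = \<delta> * L2_set (\<lambda>i. cmod ((A *v xI) $ i)) I + \<delta> * q * L2_set R I"
    using \<delta> pq by (simp add: L2_set_right_distrib)
  also have "\<dots> \<le> \<delta> * (a * p) + \<delta> * q * (c * a)"
  proof -
    have "L2_set (\<lambda>i. cmod ((A *v xI) $ i)) I \<le> norm (A *v xI)"
      unfolding norm_vec_def by (rule L2_set_subset_le) auto
    also have "\<dots> \<le> a * p" using norm_matrix_vector_le[of A xI] by (simp add: xI a_def)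
    finally show ?thesis using \<delta> pq R by (intro add_mono mult_left_mono) auto
  qed
  finally have upper: "L2_set (\<lambda>i. cmod (y $ i)) I \<le> \<delta> * a * (p + c * q)"
    by (simp add: algebra_simps)

  have "(norm y)\<^sup>2 \<le> (\<delta> * a * (p + c * q))\<^sup>2 + (\<delta> * a * (c * p))\<^sup>2"
    unfolding split_norm[of y] by (intro add_mono power_mono upper lower) auto
  also have "\<dots> = (\<delta> * a)\<^sup>2 * ((p + c * q)\<^sup>2 + (c * p)\<^sup>2)"
    by (simp add: power2_eq_square algebra_simps)
  also have "\<dots> \<le> (\<delta> * a)\<^sup>2 * (k\<^sup>2 * (p\<^sup>2 + q\<^sup>2))"
    unfolding k_def c_def by (intro mult_left_mono golden_block_bound) auto
  also have "p\<^sup>2 + q\<^sup>2 = (norm x)\<^sup>2" by (simp add: split_norm[of x] p_def q_def)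
  finally have "(norm y)\<^sup>2 \<le> (\<delta> * k * a * norm x)\<^sup>2"
    by (simp add: power_mult_distrib ac_simps)
  then have "norm y \<le> \<delta> * k * a * norm x"
    by (rule power2_le_imp_le) (use \<delta> k a in auto)
  then show "norm (schur_multiplier (\<chi> i j. complex_of_real (W i j)) A *v x)
      \<le> \<delta> * (1 + inverse golden_ratio * card (- I)) * spectral_norm A * norm x"
    by (simp add: y_def k_def a_def)
qed

subsection \<open>Matrices with entries between their diagonal entries\<close>

text \<open>Induction on the number of distinct values of \<open>d\<close>, peeling off the top
  layer. The lower bound \<open>l\<close> stays fixed, and its term absorbs the constant matrix left
  at the end.\<close>

lemma schur_multiplier_norm_between_le:
  fixes M :: "'n::finite \<Rightarrow> 'n \<Rightarrow> real" and d :: "'n \<Rightarrow> real"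
  assumes "\<And>i j. min (d i) (d j) \<le> M i j" "\<And>i j. M i j \<le> max (d i) (d j)"
    and "\<And>i. l \<le> d i"
  shows "schur_multiplier_norm (\<chi> i j. complex_of_real (M i j))
    \<le> \<bar>l\<bar> + (Max (range d) - l) + inverse golden_ratio * (\<Sum>j\<in>UNIV. Max (range d) - d j)"
  using assms
proof (induction "card (range d)" arbitrary: d M rule: less_induct)
  case less
  define s where "s = inverse golden_ratio"
  define u where "u = Max (range d)"
  have du: "d i \<le> u" for i by (simp add: u_def)
  have "u \<in> range d" unfolding u_def by (intro Max_in) auto
  then obtain i0 where i0: "d i0 = u" by auto
  show ?case
  proof (cases "range d = {u}")
    case True
    then have d: "d i = u" for i by auto
    then have "M i j = u" for i j using less.prems(1,2)[of i j] by simp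
    then have "schur_multiplier_norm (\<chi> i j. complex_of_real (M i j)) \<le> \<bar>u\<bar>"
      using schur_multiplier_norm_const_le[of "complex_of_real u"] by simp
    also have "\<dots> \<le> \<bar>l\<bar> + (u - l)" using less.prems(3)[of i0] i0 by linarith
    finally show ?thesis by (simp add: d)
  next
    case False
    \<comment> \<open>The cut is at the second largest diagonal value, so that no value of
      \<open>d\<close> lies strictly between v and u.\<close>
    define v where "v = Max (range d - {u})"
    have ne: "range d - {u} \<noteq> {}" using False i0 by auto
    have "v \<in> range d - {u}" unfolding v_def by (rule Max_in) (use ne in auto)
    then obtain i1 where i1: "d i1 = v" and vu: "v < u" using du by (auto simp: less_le)
    have dv: "d i \<le> v" if "d i \<noteq> u" for i
      unfolding v_def using that by (intro Max_ge) auto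
    define I where "I = {i. d i = u}"
    \<comment> \<open>Capping at v is monotone, hence keeps the entries between the diagonal ones,
      and it merges the value u into v.\<close>
    define M' where "M' i j = min (M i j) v" for i j
    define d' where "d' i = min (d i) v" for i
    have "range d' = range d - {u}"
    proof
      show "range d' \<subseteq> range d - {u}"
        using i1 vu by (auto simp: d'_def min_def)
      show "range d - {u} \<subseteq> range d'"
        using dv by (force simp: d'_def min_def image_iff)
    qed
    then have Max': "Max (range d') = v" and card': "card (range d') < card (range d)"
      using i0 by (auto simp: v_def intro!: psubset_card_mono)
    have IH: "schur_multiplier_norm (\<chi> i j. complex_of_real (M' i j))
        \<le> \<bar>l\<bar> + (v - l) + s * (\<Sum>j\<in>UNIV. v - d' j)"
      unfolding s_def Max'[symmetric]
    proof (rule less.hyps[OF card'])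
      fix i j
      show "min (d' i) (d' j) \<le> M' i j" "M' i j \<le> max (d' i) (d' j)"
        using less.prems(1,2)[of i j] by (auto simp: d'_def M'_def)
      show "l \<le> d' i"
        using less.prems(3)[of i] less.prems(3)[of i1] i1 by (simp add: d'_def)
    qed
    \<comment> \<open>For two indices in \<open>I\<close> the entry of M is forced to be u; for two
      outside \<open>I\<close> it is at most v, so the cap changes nothing. All entries are at most
      u, which bounds the mixed ones.\<close>
    have layer: "schur_multiplier_norm (\<chi> i j. complex_of_real (M i j - M' i j))
        \<le> (u - v) * (1 + s * card (- I))"
      unfolding s_def
    proof (rule schur_multiplier_norm_layer_le)
      fix i j
      show "M i j - M' i j = u - v" if "i \<in> I" "j \<in> I"
        using that less.prems(1,2)[of i j] vu by (auto simp: I_def M'_def)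
      show "M i j - M' i j = 0" if "i \<notin> I" "j \<notin> I"
        using that less.prems(2)[of i j] dv[of i] dv[of j] by (auto simp: I_def M'_def)
      show "\<bar>M i j - M' i j\<bar> \<le> u - v"
        using less.prems(2)[of i j] du[of i] du[of j] vu by (auto simp: M'_def)
    qed
    \<comment> \<open>The gap to the maximum shrinks by u - v exactly at the indices outside
      \<open>I\<close>; at those in \<open>I\<close> it is zero before and after. So the layer
      contributes precisely the difference of the two sums.\<close>
    have "(\<Sum>j\<in>UNIV. u - d j) = (\<Sum>j\<in>UNIV. (v - d' j) + (if j \<in> - I then u - v else 0))"
      using dv vu by (intro sum.cong) (auto simp: I_def d'_def min_def)
    also have "\<dots> = (\<Sum>j\<in>UNIV. v - d' j) + (u - v) * card (- I)"
      by (simp add: sum.distrib sum.If_cases Compl_eq)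
    finally have sums: "(\<Sum>j\<in>UNIV. u - d j) = (\<Sum>j\<in>UNIV. v - d' j) + (u - v) * card (- I)" .
    have "(\<chi> i j. complex_of_real (M i j))
        = (\<chi> i j. complex_of_real (M' i j)) + (\<chi> i j. complex_of_real (M i j - M' i j))"
      by (simp add: vec_eq_iff)
    then have "schur_multiplier_norm (\<chi> i j. complex_of_real (M i j))
        \<le> (\<bar>l\<bar> + (v - l) + s * (\<Sum>j\<in>UNIV. v - d' j)) + (u - v) * (1 + s * card (- I))"
      by (simp only:) (rule order_trans[OF schur_multiplier_norm_triangle add_mono[OF IH layer]])
    also have "\<dots> = \<bar>l\<bar> + (u - l) + s * (\<Sum>j\<in>UNIV. u - d j)"
      unfolding sums by (simp add: algebra_simps)
    finally show ?thesis by (simp add: u_def s_def)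
  qed
qed

text \<open>Since \<open>l\<close> and \<open>u\<close> are attained, they are the extremes of
  \<open>d\<close>. Negation turns them into -u and -l with the roles exchanged, so |u| replaces |l|
  and the sum measures distances from \<open>l\<close>.\<close>

lemma schur_multiplier_norm_between_le_min:
  fixes M :: "'n::finite \<Rightarrow> 'n \<Rightarrow> real" and d :: "'n \<Rightarrow> real"
  assumes lower: "\<And>i j. min (d i) (d j) \<le> M i j" and upper: "\<And>i j. M i j \<le> max (d i) (d j)"
    and l: "d i0 = l" "\<And>i. l \<le> d i" and u: "d i1 = u" "\<And>i. d i \<le> u"
  shows "schur_multiplier_norm (\<chi> i j. complex_of_real (M i j))
    \<le> (u - l) + min (\<bar>l\<bar> + inverse golden_ratio * (\<Sum>j\<in>UNIV. u - d j))
        (\<bar>u\<bar> + inverse golden_ratio * (\<Sum>j\<in>UNIV. d j - l))"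
proof -
  have Max: "Max (range d) = u" "Max (range (\<lambda>i. - d i)) = - l"
    using l u by (auto intro!: Max_eqI)
  have 1: "schur_multiplier_norm (\<chi> i j. complex_of_real (M i j))
      \<le> \<bar>l\<bar> + (u - l) + inverse golden_ratio * (\<Sum>j\<in>UNIV. u - d j)"
    using schur_multiplier_norm_between_le[of d M l] lower upper l by (simp add: Max)
  have "schur_multiplier_norm (\<chi> i j. complex_of_real (M i j))
      \<le> schur_multiplier_norm (- (\<chi> i j. complex_of_real (M i j)))"
    using schur_multiplier_norm_uminus_le[of "- (\<chi> i j. complex_of_real (M i j))"] by simp
  also have "- (\<chi> i j. complex_of_real (M i j)) = (\<chi> i j. complex_of_real (- M i j))"
    by (simp add: vec_eq_iff)
  also have "schur_multiplier_norm \<dots>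
      \<le> \<bar>- u\<bar> + (Max (range (\<lambda>i. - d i)) - - u)
        + inverse golden_ratio * (\<Sum>j\<in>UNIV. Max (range (\<lambda>i. - d i)) - - d j)"
  proof (rule schur_multiplier_norm_between_le)
    fix i j
    show "min (- d i) (- d j) \<le> - M i j" using upper[of i j] by linarith
    show "- M i j \<le> max (- d i) (- d j)" using lower[of i j] by linarith
    show "- u \<le> - d i" using u by simp
  qed
  finally show ?thesis using 1 by (simp add: Max)
qed

subsection \<open>Slopes of convex functions\<close>

text \<open>Chords from x to z, for z between x and y, have slope at most that of the chord to y;
  let z tend to x. The limit is taken from the right because convexity is known only on the
  interval.\<close>

lemma convex_on_deriv_le_slope:
  fixes f :: "real \<Rightarrow> real"
  assumes "convex_on {x..y} f" "x < y" "f differentiable (at x)"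
  shows "deriv f x \<le> (f y - f x) / (y - x)"
proof -
  have "((\<lambda>z. (f z - f x) / (z - x)) \<longlongrightarrow> deriv f x) (at_right x)"
    using assms(3) unfolding DERIV_deriv_iff_real_differentiable[symmetric] has_field_derivative_iff
    by (rule tendsto_mono[OF at_le, rotated]) simp
  moreover have "\<forall>\<^sub>F z in at_right x. (f z - f x) / (z - x) \<le> (f y - f x) / (y - x)"
    unfolding eventually_at_right[OF assms(2)]
  proof (intro exI[of _ y] conjI allI impI assms(2))
    fix z assume "x < z" "z < y"
    then show "(f z - f x) / (z - x) \<le> (f y - f x) / (y - x)"
      using convex_onD_Icc'[OF assms(1), of z] by (simp add: divide_le_eq)
  qed
  ultimately show ?thesis
    by (intro tendsto_upperbound) auto
qed

lemma convex_on_slope_le_deriv: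
  fixes f :: "real \<Rightarrow> real"
  assumes "convex_on {x..y} f" "x < y" "f differentiable (at y)"
  shows "(f y - f x) / (y - x) \<le> deriv f y"
proof -
  have "((\<lambda>z. (f z - f y) / (z - y)) \<longlongrightarrow> deriv f y) (at_left y)"
    using assms(3) unfolding DERIV_deriv_iff_real_differentiable[symmetric] has_field_derivative_iff
    by (rule tendsto_mono[OF at_le, rotated]) simp
  moreover have "\<forall>\<^sub>F z in at_left y. (f y - f x) / (y - x) \<le> (f z - f y) / (z - y)"
    unfolding eventually_at_left[OF assms(2)]
  proof (intro exI[of _ x] conjI allI impI assms(2))
    fix z assume z: "x < z" "z < y"
    have "f z - f y \<le> (f x - f y) / (y - x) * (y - z)"
      using convex_onD_Icc''[OF assms(1), of z] z by simp
    also have "\<dots> = (f y - f x) / (y - x) * (z - y)"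
      using assms(2) by (simp add: field_simps)
    finally show "(f y - f x) / (y - x) \<le> (f z - f y) / (z - y)"
      using z by (simp add: neg_le_divide_eq)
  qed
  ultimately show ?thesis
    by (intro tendsto_lowerbound) auto
qed

section \<open>Divided differences and the Loewner matrix\<close>

definition divided_difference :: "(real \<Rightarrow> real) \<Rightarrow> real \<Rightarrow> real \<Rightarrow> real" where
  "divided_difference f x y = (if x = y then deriv f x else (f x - f y) / (x - y))"

lemma loewner_matrix_eq:
  "loewner_matrix f b = (\<chi> i j. complex_of_real (divided_difference f (b i) (b j)))"
  by (simp add: loewner_matrix_def divided_difference_def)

lemma divided_difference_commute: "divided_difference f x y = divided_difference f y x"
  by (auto simp: divided_difference_def field_simps)

text \<open>Differentiability enters on the diagonal, where \<open>deriv\<close> would otherwise be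
  an unspecified value.\<close>

lemma divided_difference_uminus:
  assumes "f differentiable (at x)"
  shows "divided_difference (\<lambda>t. - f t) x y = - divided_difference f x y"
proof (cases "x = y")
  case True
  then show ?thesis
    using assms DERIV_imp_deriv[OF DERIV_minus]
    by (metis DERIV_deriv_iff_real_differentiable divided_difference_def)
next
  case False
  then show ?thesis by (simp add: divided_difference_def diff_divide_distrib)
qed

lemma convex_on_divided_difference:
  assumes "convex_on {a..c} f" "a \<le> x" "x \<le> y" "y \<le> c"
    and "f differentiable (at x)" "f differentiable (at y)"
  shows "deriv f x \<le> divided_difference f x y" "divided_difference f x y \<le> deriv f y"
proof -
  have "convex_on {x..y} f"
    using convex_on_subset[OF assms(1)] assms by simp
  moreover have "(f x - f y) / (x - y) = (f y - f x) / (y - x)"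
    by (metis minus_diff_eq minus_divide_divide)
  ultimately show "deriv f x \<le> divided_difference f x y" "divided_difference f x y \<le> deriv f y"
    using assms convex_on_deriv_le_slope[of x y f] convex_on_slope_le_deriv[of x y f]
    by (cases "x = y"; simp add: divided_difference_def)+
qed

lemma convex_divided_difference_between:
  fixes b :: "'n::{finite,linorder} \<Rightarrow> real"
  assumes "mono b" "\<And>j. f differentiable (at (b j))"
    and "convex_on {b (Min UNIV)..b (Max UNIV)} f"
  shows "min (deriv f (b i)) (deriv f (b j)) \<le> divided_difference f (b i) (b j)"
    and "divided_difference f (b i) (b j) \<le> max (deriv f (b i)) (deriv f (b j))"
    and "deriv f (b (Min UNIV)) \<le> deriv f (b i)" "deriv f (b i) \<le> deriv f (b (Max UNIV))"
proof -
  have range: "b (Min UNIV) \<le> b i" "b i \<le> b (Max UNIV)" for i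
    using assms(1) by (auto intro!: monoD[OF assms(1)])
  have slope: "deriv f (b i) \<le> divided_difference f (b i) (b j)"
      "divided_difference f (b i) (b j) \<le> deriv f (b j)" if "b i \<le> b j" for i j
    using convex_on_divided_difference[OF assms(3)] range that assms(2) by blast+
  show "min (deriv f (b i)) (deriv f (b j)) \<le> divided_difference f (b i) (b j)"
    "divided_difference f (b i) (b j) \<le> max (deriv f (b i)) (deriv f (b j))"
    using slope[of i j] slope[of j i] divided_difference_commute[of f "b i" "b j"] by linarith+
  \<comment> \<open>Chaining the two slope bounds through the divided difference makes the
    derivative monotone along the eigenvalues.\<close>
  show "deriv f (b (Min UNIV)) \<le> deriv f (b i)" "deriv f (b i) \<le> deriv f (b (Max UNIV))"
    using slope[OF range(1)] slope[OF range(2)] order_trans by blast+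
qed

section \<open>The bounds for concave and convex functions\<close>

theorem theorem4:
  fixes B L :: "complex^'n::{finite,linorder}^'n::{finite,linorder}"
    and b :: "'n \<Rightarrow> real"
    and f :: "real \<Rightarrow> real"
    and b\<^sub>1 b\<^sub>n \<alpha> \<beta> \<phi> :: real
  assumes "hermitian B"
    and "eigenvalue_family B b"
    and "mono b"
    and "\<And>j. f differentiable (at (b j))"
    and "L = loewner_matrix f b"
    and "b\<^sub>1 = b (Min UNIV)"
    and "b\<^sub>n = b (Max UNIV)"
    and "\<alpha> = deriv f b\<^sub>1"
    and "\<beta> = deriv f b\<^sub>n"
    and "\<phi> = golden_ratio"
  shows "(concave_on {b\<^sub>1..b\<^sub>n} f \<longrightarrow>
      schur_multiplier_norm L \<le> (\<alpha> - \<beta>) +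
        min (\<bar>\<beta>\<bar> + inverse \<phi> * (\<Sum>j\<in>UNIV. \<alpha> - deriv f (b j)))
            (\<bar>\<alpha>\<bar> + inverse \<phi> * (\<Sum>j\<in>UNIV. deriv f (b j) - \<beta>)))
    \<and> (convex_on {b\<^sub>1..b\<^sub>n} f \<longrightarrow>
      schur_multiplier_norm L \<le> (\<beta> - \<alpha>) +
        min (\<bar>\<beta>\<bar> + inverse \<phi> * (\<Sum>j\<in>UNIV. deriv f (b j) - \<alpha>))
            (\<bar>\<alpha>\<bar> + inverse \<phi> * (\<Sum>j\<in>UNIV. \<beta> - deriv f (b j))))"
proof (intro conjI impI)
  note b = \<open>mono b\<close> and diff = \<open>\<And>j. f differentiable (at (b j))\<close>
  note params = \<open>b\<^sub>1 = b (Min UNIV)\<close> \<open>b\<^sub>n = b (Max UNIV)\<close> \<open>\<alpha> = deriv f b\<^sub>1\<close> \<open>\<beta> = deriv f b\<^sub>n\<close>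
    \<open>\<phi> = golden_ratio\<close>
  note L = \<open>L = loewner_matrix f b\<close>[unfolded loewner_matrix_eq]
  {
    assume "convex_on {b\<^sub>1..b\<^sub>n} f"
    note between = convex_divided_difference_between[OF b diff this[unfolded params]]
    show "schur_multiplier_norm L \<le> (\<beta> - \<alpha>) +
        min (\<bar>\<beta>\<bar> + inverse \<phi> * (\<Sum>j\<in>UNIV. deriv f (b j) - \<alpha>))
            (\<bar>\<alpha>\<bar> + inverse \<phi> * (\<Sum>j\<in>UNIV. \<beta> - deriv f (b j)))"
      \<comment> \<open>Here l = \<alpha> and u = \<beta>, so the general bound lists its two
        alternatives in the opposite order.\<close>
      unfolding L params min.commute[of "\<bar>deriv f (b (Max UNIV))\<bar> + _"]
      by (rule schur_multiplier_norm_between_le_min[where d = "\<lambda>i. deriv f (b i)"])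
        (rule between refl)+
  next
    assume "concave_on {b\<^sub>1..b\<^sub>n} f"
    \<comment> \<open>The slope inequalities are taken from -f and negated. The derivative of f now
      decreases, hence l = \<beta> and u = \<alpha>.\<close>
    then have "convex_on {b\<^sub>1..b\<^sub>n} (\<lambda>x. - f x)" by (simp add: concave_on_def)
    note between = convex_divided_difference_between[OF b _ this[unfolded params]]
    have deriv: "deriv (\<lambda>x. - f x) (b i) = - deriv f (b i)" for i
      using divided_difference_uminus[OF diff, of i "b i"] by (simp add: divided_difference_def)
    note between' = between[OF differentiable_minus[OF diff],
        unfolded deriv divided_difference_uminus[OF diff]]
    show "schur_multiplier_norm L \<le> (\<alpha> - \<beta>) +
        min (\<bar>\<beta>\<bar> + inverse \<phi> * (\<Sum>j\<in>UNIV. \<alpha> - deriv f (b j)))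
            (\<bar>\<alpha>\<bar> + inverse \<phi> * (\<Sum>j\<in>UNIV. deriv f (b j) - \<beta>))"
      unfolding L params
    proof (rule schur_multiplier_norm_between_le_min[where d = "\<lambda>i. deriv f (b i)"])
      fix i j
      show "min (deriv f (b i)) (deriv f (b j)) \<le> divided_difference f (b i) (b j)"
        using between'(2)[of i j] by linarith
      show "divided_difference f (b i) (b j) \<le> max (deriv f (b i)) (deriv f (b j))"
        using between'(1)[of i j] by linarith
      show "deriv f (b (Max UNIV)) \<le> deriv f (b i)" "deriv f (b i) \<le> deriv f (b (Min UNIV))"
        using between'(3,4)[of i] by linarith+
    qed (rule refl)+
  }
qed

end
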